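(* If $f$ is a conformally indecomposable flow on $(\Sigma,\omega)$, then there exists a directed closed, positive walk $(W,\omega_f)$ on $\Sigma(f)$ such that $f=f_{(W,\,\omega_f)}$. Furthermore, if $(\widetilde{W},\,\widetilde{\omega}_f)$ is a lift of $(W,\,\omega_f)$, then $\widetilde{W}$ is a circle, and $f_{(\widetilde{W},\,\widetilde{\omega}_f)}$ is a lift of $f$ and is a conformally indecomposable flow on $(\widetilde\Sigma,\widetilde\omega)$.
   Context: $\Sigma=(G,\sigma)$ is a signed graph (each edge has sign $\pm1$; loops have two distinguishable ends). An orientation $\omega$ assigns $\pm1$ to each edge end with $\sigma(e)=-\omega(u,e)\omega(v,e)$ for $e$ with endpoints $u,v$. A walk $W=v_0e_1v_1\cdots e_nv_n$ has sign $\prod\sigma(e_i)$; a direction $\omega_W$ of $W$ orients its edges so that it is coherent at internal vertices ($\omega_W(v_i,e_i)+\omega_W(v_i,e_{i+1})=0$), and also at $v_0=v_n$ if the walk is directed closed. An integral flow on $(\Sigma,\omega)$ is $f:E\to\mathbb Z$ with $\sum_{(v,e)\text{ ends at }v}\omega(v,e)f(e)=0$ at every vertex $v$. For a directed walk, $f_{(W,\omega_W)}(e)=\sum_{e_i=e}[\omega,\omega_W](e_i)$, where the coupling $[\omega_1,\omega_2](e)=\omega_1(v,e)\omega_2(v,e)$ ($0$ if $e$ not in both). $\Sigma(f)$ is the subgraph formed by the support of $f$. $\omega_f$ is the orientation equal to $\omega$ on edges with $f(e)\ge0$ and to $-\omega$ on edges with $f(e)<0$. A flow $f$ is conformally indecomposable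 if it is nonzero and not a sum $f_1+f_2$ of two nonzero integral flows with $f_1(e)f_2(e)\ge0$ for all $e$. The double covering graph $\widetilde\Sigma$ has vertices $v^{\pm}$ and edges $\tilde e,\tilde e^*$ for each edge $e$, where an edge $e$ joining $u,v$ lifts to edges joining $u^\alpha$ and $v^{\alpha\sigma(e)}$ for $\alpha=\pm$; the projection $\pi$ sends $v^\alpha\mapsto v$, $\tilde e,\tilde e^*\mapsto e$. The lifted orientation is $\widetilde\omega(v^\alpha,e^\beta)=\alpha\,\omega(v,e)$ (making $(\widetilde\Sigma,\widetilde\omega)$ an ordinary oriented graph), and similarly a direction $\omega_W$ lifts to $\widetilde\omega_W$. A lift of a walk $W$ is $\widetilde W=v_0^{\alpha_0}\tilde e_1v_1^{\alpha_1}\cdots\tilde e_nv_n^{\alpha_n}$ with $\alpha_i=\alpha_{i-1}\sigma(e_i)$, $\tilde e_i$ the lift of $e_i$ joining $v_{i-1}^{\alpha_{i-1}}$ and $v_i^{\alpha_i}$. The projection of $\tilde f:E(\widetilde\Sigma)\to\mathbb Z$ is $\pi(\tilde f)(e)=\tilde f(\tilde e)+\tilde f(\tilde e^* )$, and a lift of a flow $f$ is a flow $\tilde f$ on $(\widetilde\Sigma,\widetilde\omega)$ with $\pi(\tilde f)=f$. A circle is a connected 2-regular subgraph. *)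

theory Defs
  imports Main
begin

text \<open>
  Every edge, loop or not, has two ends, indexed by \<open>bool\<close>; \<open>sg_end S e b\<close> is the vertex at end
  \<open>b\<close> of \<open>e\<close>.  Hence the two ends of a loop are distinguishable, and parallel edges are allowed.
  Signs are the integers \<open>1\<close> and \<open>-1\<close>.
\<close>

record ('v, 'e) sgraph =
  sg_verts :: "'v set"
  sg_edges :: "'e set"
  sg_end :: "'e \<Rightarrow> bool \<Rightarrow> 'v"
  sg_sign :: "'e \<Rightarrow> int"

definition signed_graph :: "('v, 'e) sgraph \<Rightarrow> bool" where
  "signed_graph S \<longleftrightarrow>
     finite (sg_verts S) \<and> finite (sg_edges S) \<and>
     (\<forall>e\<in>sg_edges S. (\<forall>b. sg_end S e b \<in> sg_verts S) \<and> sg_sign S e \<in> {1, -1})"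

definition ends_at :: "('v, 'e) sgraph \<Rightarrow> 'v \<Rightarrow> ('e \<times> bool) set" where
  "ends_at S v = {(e, b). e \<in> sg_edges S \<and> sg_end S e b = v}"

type_synonym 'e orient = "'e \<Rightarrow> bool \<Rightarrow> int"

definition orientation :: "('v, 'e) sgraph \<Rightarrow> 'e orient \<Rightarrow> bool" where
  "orientation S \<omega> \<longleftrightarrow>
     (\<forall>e\<in>sg_edges S. (\<forall>b. \<omega> e b \<in> {1, -1}) \<and> sg_sign S e = - (\<omega> e False * \<omega> e True))"

text \<open>
  Functions on the edge set are total functions whose values outside \<open>sg_edges S\<close> are irrelevant;
  all (in)equalities between them are stated on \<open>sg_edges S\<close> only.
\<close>

definition is_flow :: "('v, 'e) sgraph \<Rightarrow> 'e orient \<Rightarrow> ('e \<Rightarrow> int) \<Rightarrow> bool" where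
  "is_flow S \<omega> f \<longleftrightarrow> (\<forall>v\<in>sg_verts S. (\<Sum>(e, b)\<in>ends_at S v. \<omega> e b * f e) = 0)"

definition nonzero_on :: "('v, 'e) sgraph \<Rightarrow> ('e \<Rightarrow> int) \<Rightarrow> bool" where
  "nonzero_on S f \<longleftrightarrow> (\<exists>e\<in>sg_edges S. f e \<noteq> 0)"

definition conformally_indecomposable ::
    "('v, 'e) sgraph \<Rightarrow> 'e orient \<Rightarrow> ('e \<Rightarrow> int) \<Rightarrow> bool" where
  "conformally_indecomposable S \<omega> f \<longleftrightarrow>
     is_flow S \<omega> f \<and> nonzero_on S f \<and>
     \<not> (\<exists>f1 f2. is_flow S \<omega> f1 \<and> nonzero_on S f1 \<and> is_flow S \<omega> f2 \<and> nonzero_on S f2 \<and>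
          (\<forall>e\<in>sg_edges S. f e = f1 e + f2 e) \<and> (\<forall>e\<in>sg_edges S. f1 e * f2 e \<ge> 0))"

definition support_subgraph :: "('v, 'e) sgraph \<Rightarrow> ('e \<Rightarrow> int) \<Rightarrow> ('v, 'e) sgraph" where
  "support_subgraph S f =
     S\<lparr>sg_verts := {sg_end S e b |e b. e \<in> sg_edges S \<and> f e \<noteq> 0},
       sg_edges := {e \<in> sg_edges S. f e \<noteq> 0}\<rparr>"

definition flow_orient :: "'e orient \<Rightarrow> ('e \<Rightarrow> int) \<Rightarrow> 'e orient" where
  "flow_orient \<omega> f = (\<lambda>e b. if f e \<ge> 0 then \<omega> e b else - \<omega> e b)"

subsection \<open>Walks and directions\<close>

text \<open>
  A walk is its initial vertex together with its list of steps.  The step \<open>(e, b)\<close> leaves along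
  end \<open>b\<close> of \<open>e\<close> and arrives along the other end, so that a walk also records in which of the two
  ways it traverses a loop.
\<close>

type_synonym ('v, 'e) walk = "'v \<times> ('e \<times> bool) list"

abbreviation wlen :: "('v, 'e) walk \<Rightarrow> nat" where
  "wlen W \<equiv> length (snd W)"

text \<open>Steps are numbered from \<open>0\<close>: step \<open>i\<close> leads from vertex \<open>i\<close> to vertex \<open>i + 1\<close> of the walk.\<close>

definition wedge :: "('v, 'e) walk \<Rightarrow> nat \<Rightarrow> 'e" where
  "wedge W i = fst (snd W ! i)"

definition out_end :: "('v, 'e) walk \<Rightarrow> nat \<Rightarrow> bool" where
  "out_end W i = snd (snd W ! i)"

definition in_end :: "('v, 'e) walk \<Rightarrow> nat \<Rightarrow> bool" where
  "in_end W i = (\<not> out_end W i)"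

fun wvert :: "('v, 'e) sgraph \<Rightarrow> ('v, 'e) walk \<Rightarrow> nat \<Rightarrow> 'v" where
  "wvert S W 0 = fst W"
| "wvert S W (Suc i) = sg_end S (wedge W i) (in_end W i)"

definition is_walk :: "('v, 'e) sgraph \<Rightarrow> ('v, 'e) walk \<Rightarrow> bool" where
  "is_walk S W \<longleftrightarrow>
     fst W \<in> sg_verts S \<and>
     (\<forall>i<wlen W. wedge W i \<in> sg_edges S \<and> sg_end S (wedge W i) (out_end W i) = wvert S W i)"

definition closed_walk :: "('v, 'e) sgraph \<Rightarrow> ('v, 'e) walk \<Rightarrow> bool" where
  "closed_walk S W \<longleftrightarrow> is_walk S W \<and> wlen W > 0 \<and> wvert S W (wlen W) = wvert S W 0"

definition wsign :: "('v, 'e) sgraph \<Rightarrow> ('v, 'e) walk \<Rightarrow> int" where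
  "wsign S W = (\<Prod>i<wlen W. sg_sign S (wedge W i))"

text \<open>
  A direction orients each occurrence of an edge in the walk separately: \<open>d i b\<close> is the value at
  end \<open>b\<close> of the edge of step \<open>i\<close>.
\<close>

type_synonym direction = "nat \<Rightarrow> bool \<Rightarrow> int"

definition is_direction :: "('v, 'e) sgraph \<Rightarrow> ('v, 'e) walk \<Rightarrow> direction \<Rightarrow> bool" where
  "is_direction S W d \<longleftrightarrow>
     (\<forall>i<wlen W. (\<forall>b. d i b \<in> {1, -1}) \<and> sg_sign S (wedge W i) = - (d i False * d i True)) \<and>
     (\<forall>i. Suc i < wlen W \<longrightarrow> d i (in_end W i) + d (Suc i) (out_end W (Suc i)) = 0)"

definition directed_closed :: "('v, 'e) sgraph \<Rightarrow> ('v, 'e) walk \<Rightarrow> direction \<Rightarrow> bool" where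
  "directed_closed S W d \<longleftrightarrow>
     closed_walk S W \<and> is_direction S W d \<and>
     d (wlen W - 1) (in_end W (wlen W - 1)) + d 0 (out_end W 0) = 0"

definition induced_dir :: "'e orient \<Rightarrow> ('v, 'e) walk \<Rightarrow> direction" where
  "induced_dir \<omega> W = (\<lambda>i. \<omega> (wedge W i))"

text \<open>
  The coupling of two orientations of one edge; evaluating at the other end gives the same value,
  since the product of the two end values of an orientation is determined by the sign of the edge.
\<close>

definition coupling :: "(bool \<Rightarrow> int) \<Rightarrow> (bool \<Rightarrow> int) \<Rightarrow> int" where
  "coupling o1 o2 = o1 False * o2 False"

definition walk_flow :: "'e orient \<Rightarrow> ('v, 'e) walk \<Rightarrow> direction \<Rightarrow> 'e \<Rightarrow> int" where
  "walk_flow \<omega> W d e = (\<Sum>i | i < wlen W \<and> wedge W i = e. coupling (\<omega> e) (d i))"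

subsection \<open>Circles\<close>

definition connected_graph :: "('v, 'e) sgraph \<Rightarrow> bool" where
  "connected_graph S \<longleftrightarrow>
     sg_verts S \<noteq> {} \<and>
     (\<forall>u\<in>sg_verts S. \<forall>v\<in>sg_verts S. \<exists>W. is_walk S W \<and> wvert S W 0 = u \<and> wvert S W (wlen W) = v)"

definition is_circle :: "('v, 'e) sgraph \<Rightarrow> bool" where
  "is_circle S \<longleftrightarrow> connected_graph S \<and> (\<forall>v\<in>sg_verts S. card (ends_at S v) = 2)"

definition walk_subgraph :: "('v, 'e) sgraph \<Rightarrow> ('v, 'e) walk \<Rightarrow> ('v, 'e) sgraph" where
  "walk_subgraph S W = S\<lparr>sg_verts := wvert S W ` {..wlen W}, sg_edges := wedge W ` {..<wlen W}\<rparr>"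

text \<open>
  A walk is a circle if it goes exactly once around a circle; repeated edges are excluded because
  a walk going around twice has the same underlying subgraph.
\<close>

definition circle_walk :: "('v, 'e) sgraph \<Rightarrow> ('v, 'e) walk \<Rightarrow> bool" where
  "circle_walk S W \<longleftrightarrow>
     closed_walk S W \<and> inj_on (wedge W) {..<wlen W} \<and> is_circle (walk_subgraph S W)"

subsection \<open>The double covering graph\<close>

text \<open>
  The vertex \<open>v\<^sup>\<alpha>\<close> is \<open>(v, \<alpha>)\<close>.  The lift \<open>(e, \<beta>)\<close> of \<open>e\<close> is the one whose end \<open>False\<close> is at level
  \<open>\<beta>\<close>; its end \<open>True\<close> is then at level \<open>\<beta> * sg_sign S e\<close>.  The two lifts of \<open>e\<close> are \<open>(e, 1)\<close> and
  \<open>(e, -1)\<close>.  An ordinary graph is a signed graph all of whose edges are positive.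
\<close>

definition double_cover :: "('v, 'e) sgraph \<Rightarrow> ('v \<times> int, 'e \<times> int) sgraph" where
  "double_cover S =
     \<lparr>sg_verts = sg_verts S \<times> {1, -1},
      sg_edges = sg_edges S \<times> {1, -1},
      sg_end = (\<lambda>(e, \<beta>) b. (sg_end S e b, if b then \<beta> * sg_sign S e else \<beta>)),
      sg_sign = (\<lambda>_. 1)\<rparr>"

definition end_level :: "('v, 'e) sgraph \<Rightarrow> 'e \<times> int \<Rightarrow> bool \<Rightarrow> int" where
  "end_level S e' b = snd (sg_end (double_cover S) e' b)"

definition lift_orient :: "('v, 'e) sgraph \<Rightarrow> 'e orient \<Rightarrow> ('e \<times> int) orient" where
  "lift_orient S \<omega> = (\<lambda>e' b. end_level S e' b * \<omega> (fst e') b)"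

text \<open>
  A lift traverses the lifted edges in the same way as the walk below traverses the edges
  (\<open>out_end\<close> is preserved), which singles out one of the two lifts of a negative loop.
\<close>

definition walk_lift ::
    "('v, 'e) sgraph \<Rightarrow> ('v, 'e) walk \<Rightarrow> ('v \<times> int, 'e \<times> int) walk \<Rightarrow> bool" where
  "walk_lift S W W' \<longleftrightarrow>
     is_walk (double_cover S) W' \<and> wlen W' = wlen W \<and>
     (\<forall>i<wlen W. fst (wedge W' i) = wedge W i \<and> out_end W' i = out_end W i) \<and>
     (\<exists>\<alpha> :: nat \<Rightarrow> int. \<alpha> 0 \<in> {1, -1} \<and>
        (\<forall>i<wlen W. \<alpha> (Suc i) = \<alpha> i * sg_sign S (wedge W i)) \<and>
        (\<forall>i\<le>wlen W. wvert (double_cover S) W' i = (wvert S W i, \<alpha> i)))"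

definition lift_dir ::
    "('v, 'e) sgraph \<Rightarrow> ('v \<times> int, 'e \<times> int) walk \<Rightarrow> direction \<Rightarrow> direction" where
  "lift_dir S W' d = (\<lambda>i b. end_level S (wedge W' i) b * d i b)"

definition proj_fun :: "('e \<times> int \<Rightarrow> int) \<Rightarrow> 'e \<Rightarrow> int" where
  "proj_fun f' e = f' (e, 1) + f' (e, -1)"

definition flow_lift ::
    "('v, 'e) sgraph \<Rightarrow> 'e orient \<Rightarrow> ('e \<Rightarrow> int) \<Rightarrow> ('e \<times> int \<Rightarrow> int) \<Rightarrow> bool" where
  "flow_lift S \<omega> f f' \<longleftrightarrow>
     is_flow (double_cover S) (lift_orient S \<omega>) f' \<and> (\<forall>e\<in>sg_edges S. proj_fun f' e = f e)"

end

theory Submission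
  imports Defs
begin

text \<open>
  Reorient \<open>\<Sigma>\<close> by \<open>\<tau> = \<omega>\<^sub>f\<close>, so that \<open>|f|\<close> is a flow, and let a step that leaves \<open>v\<close> through an end
  of sign \<open>s\<close> start in the state \<open>(v, s)\<close>; a walk is coherently directed by \<open>\<tau>\<close> iff consecutive
  steps agree in their states.  A longest such walk using each edge \<open>e\<close> at most \<open>|f(e)|\<close> times is
  closed, since otherwise conservation provides one more step.  Every nonempty closed walk of
  this kind splits off a conformal summand of \<open>f\<close> and hence carries all of \<open>f\<close>; so it has no proper
  closed part and its states are pairwise distinct.  In a lift, the level \<open>\<alpha>\<^sub>i\<close> times the sign
  of the \<open>i\<close>-th state is constant, so that distinct states are distinct vertices of the double
  cover and the lift is a circle.  A conformal decomposition of the lifted flow would project to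
  one of \<open>f\<close>.
\<close>

section \<open>Chains of states\<close>

definition tail_state :: "('v, 'e) sgraph \<Rightarrow> 'e orient \<Rightarrow> 'e \<times> bool \<Rightarrow> 'v \<times> int" where
  "tail_state S \<tau> x = (sg_end S (fst x) (snd x), \<tau> (fst x) (snd x))"

text \<open>The sign at the arriving end is negated so that coherence at an internal vertex, where
  the two signs sum to zero, becomes equality of a head state with the next tail state.\<close>

definition head_state :: "('v, 'e) sgraph \<Rightarrow> 'e orient \<Rightarrow> 'e \<times> bool \<Rightarrow> 'v \<times> int" where
  "head_state S \<tau> x = (sg_end S (fst x) (\<not> snd x), - \<tau> (fst x) (\<not> snd x))"

fun chain :: "('v, 'e) sgraph \<Rightarrow> 'e orient \<Rightarrow> 'v \<times> int \<Rightarrow> ('e \<times> bool) list \<Rightarrow> 'v \<times> int \<Rightarrow> bool" where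
  "chain S \<tau> p [] q \<longleftrightarrow> p = q"
| "chain S \<tau> p (x # xs) q \<longleftrightarrow>
     fst x \<in> sg_edges S \<and> tail_state S \<tau> x = p \<and> chain S \<tau> (head_state S \<tau> x) xs q"

text \<open>Built like \<open>wvert\<close>, reading only the previous step, so that its first
  component is the vertex of the walk even for lists that are not chains.\<close>

definition state_at ::
    "('v, 'e) sgraph \<Rightarrow> 'e orient \<Rightarrow> 'v \<times> int \<Rightarrow> ('e \<times> bool) list \<Rightarrow> nat \<Rightarrow> 'v \<times> int" where
  "state_at S \<tau> p xs i = (case i of 0 \<Rightarrow> p | Suc j \<Rightarrow> head_state S \<tau> (xs ! j))"

abbreviation edge_count :: "('e \<times> bool) list \<Rightarrow> 'e \<Rightarrow> int" where
  "edge_count xs e \<equiv> int (count_list (map fst xs) e)"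

lemma state_at_0 [simp]: "state_at S \<tau> p xs 0 = p"
  and state_at_Suc [simp]: "state_at S \<tau> p xs (Suc i) = head_state S \<tau> (xs ! i)"
  by (simp_all add: state_at_def)

lemma chain_iff:
  "chain S \<tau> p xs q \<longleftrightarrow>
     (\<forall>i<length xs. fst (xs ! i) \<in> sg_edges S \<and> tail_state S \<tau> (xs ! i) = state_at S \<tau> p xs i) \<and>
     state_at S \<tau> p xs (length xs) = q"
proof (induction xs arbitrary: p)
  case (Cons x xs)
  have *: "state_at S \<tau> p (x # xs) (Suc i) = state_at S \<tau> (head_state S \<tau> x) xs i" for i
    by (cases i) simp_all
  show ?case
    using * by (auto simp: Cons.IH All_less_Suc2 simp del: state_at_Suc)
qed simp

lemma chain_append:
  "chain S \<tau> p (xs @ ys) q \<longleftrightarrow> (\<exists>r. chain S \<tau> p xs r \<and> chain S \<tau> r ys q)"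
  by (induction xs arbitrary: p) auto

lemma chain_split:
  assumes "chain S \<tau> p xs q" and "i \<le> length xs"
  shows "chain S \<tau> p (take i xs) (state_at S \<tau> p xs i)"
    and "chain S \<tau> (state_at S \<tau> p xs i) (drop i xs) q"
proof -
  have "chain S \<tau> p (take i xs @ drop i xs) q"
    using assms(1) by simp
  then obtain r where r: "chain S \<tau> p (take i xs) r" "chain S \<tau> r (drop i xs) q"
    unfolding chain_append by blast
  have "state_at S \<tau> p (take i xs) i = state_at S \<tau> p xs i"
    by (cases i) simp_all
  then have "r = state_at S \<tau> p xs i"
    using r(1) assms(2) by (simp add: chain_iff)
  with r show "chain S \<tau> p (take i xs) (state_at S \<tau> p xs i)"
    and "chain S \<tau> (state_at S \<tau> p xs i) (drop i xs) q" by simp_all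
qed

lemma wvert_eq_state_at: "wvert S (fst p, xs) i = fst (state_at S \<tau> p xs i)"
  by (cases i) (simp_all add: wedge_def in_end_def out_end_def head_state_def)

section \<open>Boundary of a chain\<close>

lemma finite_ends_at: "finite (sg_edges S) \<Longrightarrow> finite (ends_at S v)"
  by (rule finite_subset[of _ "sg_edges S \<times> UNIV"]) (auto simp: ends_at_def)

text \<open>The ends are named from an arbitrary \<open>c\<close>, later the end through which a
  step leaves. A loop at \<open>v\<close> contributes both terms.\<close>

lemma sum_ends_at_single:
  assumes "finite (sg_edges S)" and "a \<in> sg_edges S"
  shows "(\<Sum>(e, b)\<in>ends_at S v. (\<tau> e b :: int) * (if e = a then 1 else 0)) =
    (if sg_end S a c = v then \<tau> a c else 0) +
    (if sg_end S a (\<not> c) = v then \<tau> a (\<not> c) else 0)"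
proof -
  have "(\<Sum>(e, b)\<in>ends_at S v. \<tau> e b * (if e = a then 1 else 0)) =
    (\<Sum>(e, b)\<in>sg_edges S \<times> UNIV. if e = a then if sg_end S e b = v then \<tau> e b else 0 else 0)"
    using assms(1) by (intro sum.mono_neutral_cong_left) (auto simp: ends_at_def split: if_splits)
  also have "\<dots> = (\<Sum>e\<in>sg_edges S. if e = a then
      (\<Sum>b\<in>UNIV. if sg_end S e b = v then \<tau> e b else 0) else 0)"
    by (auto simp: sum.cartesian_product[symmetric] intro!: sum.cong)
  also have "\<dots> = (\<Sum>b\<in>UNIV. if sg_end S a b = v then \<tau> a b else 0)"
    using assms by simp
  also have "\<dots> = (if sg_end S a c = v then \<tau> a c else 0) +
    (if sg_end S a (\<not> c) = v then \<tau> a (\<not> c) else 0)"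
    by (cases c) (simp_all add: UNIV_bool)
  finally show ?thesis .
qed

text \<open>The sum telescopes: by the negation in \<open>head_state\<close>, a step contributes the
  sign of its tail state at the tail vertex minus that of its head state at the head vertex.\<close>

lemma chain_boundary:
  assumes "finite (sg_edges S)" and "chain S \<tau> p xs q"
  shows "(\<Sum>(e, b)\<in>ends_at S v. \<tau> e b * edge_count xs e) =
    (if fst p = v then snd p else 0) - (if fst q = v then snd q else 0)"
  using assms(2)
proof (induction xs arbitrary: p)
  case (Cons x xs)
  let ?e = "fst x" and ?b = "snd x"
  have "(\<Sum>(e, b)\<in>ends_at S v. \<tau> e b * edge_count (x # xs) e) =
    (\<Sum>(e, b)\<in>ends_at S v. \<tau> e b * (if e = ?e then 1 else 0)) +
    (\<Sum>(e, b)\<in>ends_at S v. \<tau> e b * edge_count xs e)"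
    by (auto simp: sum.distrib[symmetric] algebra_simps intro!: sum.cong)
  then show ?case
    using Cons.prems sum_ends_at_single[OF assms(1), where \<tau> = \<tau> and v = v and a = ?e and c = ?b] Cons.IH[of "head_state S \<tau> x"]
    by (auto simp: head_state_def tail_state_def)
qed simp

lemma chain_closed_flow:
  assumes "finite (sg_edges S)" and "chain S \<tau> p xs p"
  shows "is_flow S \<tau> (edge_count xs)"
  using chain_boundary[OF assms] by (simp add: is_flow_def)

section \<open>Signs and directions of chains\<close>

lemma orientation_unit: "orientation S \<tau> \<Longrightarrow> e \<in> sg_edges S \<Longrightarrow> \<tau> e b * \<tau> e b = 1"
  unfolding orientation_def by (cases "\<tau> e b = 1") force+

lemma orientation_sign:
  "orientation S \<tau> \<Longrightarrow> e \<in> sg_edges S \<Longrightarrow> sg_sign S e = - (\<tau> e b * \<tau> e (\<not> b))"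
  unfolding orientation_def by (cases b) (simp_all add: mult.commute)

text \<open>Since \<open>\<tau> e b\<close> squares to 1, multiplying the sign of a tail state by
  the sign of the edge gives the sign of the head state.\<close>

lemma chain_sign:
  assumes "orientation S \<tau>" and "chain S \<tau> p xs q"
  shows "snd p * (\<Prod>i<length xs. sg_sign S (fst (xs ! i))) = snd q"
  using assms(2)
proof (induction xs arbitrary: p)
  case (Cons x xs)
  have e: "fst x \<in> sg_edges S" and p: "p = tail_state S \<tau> x"
    and c: "chain S \<tau> (head_state S \<tau> x) xs q"
    using Cons.prems by auto
  have "snd p * sg_sign S (fst x) = snd (head_state S \<tau> x)"
    using orientation_unit[OF assms(1) e] orientation_sign[OF assms(1) e, of "snd x"]
    by (simp add: p head_state_def tail_state_def mult.assoc[symmetric])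
  then show ?case
    using Cons.IH[OF c] by (simp add: prod.lessThan_Suc_shift mult.assoc[symmetric] del: prod.lessThan_Suc)
qed simp

lemma chain_state_sign:
  assumes "orientation S \<tau>" and "chain S \<tau> p xs p" and "xs \<noteq> []" and "i \<le> length xs"
  shows "snd (state_at S \<tau> p xs i) \<in> {1, -1}"
proof (cases "i < length xs")
  case True
  then show ?thesis
    using assms unfolding chain_iff orientation_def tail_state_def by (metis snd_conv)
next
  case False
  then have "state_at S \<tau> p xs i = state_at S \<tau> p xs 0" "0 < length xs"
    using assms unfolding chain_iff by auto
  then show ?thesis
    using assms unfolding chain_iff orientation_def tail_state_def by (metis snd_conv)
qed

text \<open>A closed chain returns to the sign \<open>snd p\<close>, a unit that can be cancelled.
  The initial vertex \<open>u\<close> is free because it does not enter the sign of a walk.\<close>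

lemma chain_wsign:
  assumes "orientation S \<tau>" and "chain S \<tau> p xs p" and "xs \<noteq> []"
  shows "wsign S (u, xs) = 1"
  using chain_sign[OF assms(1,2)] chain_state_sign[OF assms, of 0]
  by (auto simp: wsign_def wedge_def)

text \<open>Equality of the last and first states gives both the return to the initial vertex and
  coherence there. The theorem applies this in the support subgraph.\<close>

lemma chain_directed_closed:
  assumes "orientation S \<tau>" and "chain S \<tau> p xs p" and "xs \<noteq> []" and "fst p \<in> sg_verts S"
  shows "directed_closed S (fst p, xs) (induced_dir \<tau> (fst p, xs))"
proof -
  let ?W = "(fst p, xs)" and ?n = "length xs"
  have arc: "fst (xs ! i) \<in> sg_edges S" "tail_state S \<tau> (xs ! i) = state_at S \<tau> p xs i"
    if "i < ?n" for i
    using assms(2) that unfolding chain_iff by blast+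
  have end_state: "state_at S \<tau> p xs ?n = p"
    using assms(2) unfolding chain_iff by blast
  have closed: "closed_walk S ?W"
    using assms(3,4) arc end_state unfolding closed_walk_def is_walk_def
    by (auto simp: wvert_eq_state_at[of _ _ _ _ \<tau>] wedge_def out_end_def tail_state_def
        simp flip: arc(2))
  have dir: "is_direction S ?W (induced_dir \<tau> ?W)"
    unfolding is_direction_def
  proof (intro conjI allI impI)
    fix i assume "Suc i < wlen ?W"
    then have "tail_state S \<tau> (xs ! Suc i) = head_state S \<tau> (xs ! i)"
      using arc(2)[of "Suc i"] by simp
    then show "induced_dir \<tau> ?W i (in_end ?W i) + induced_dir \<tau> ?W (Suc i) (out_end ?W (Suc i)) = 0"
      by (simp add: induced_dir_def in_end_def out_end_def wedge_def tail_state_def head_state_def)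
  qed (use assms(1) arc(1) in \<open>auto simp: orientation_def induced_dir_def wedge_def\<close>)
  have "tail_state S \<tau> (xs ! 0) = head_state S \<tau> (xs ! (?n - 1))"
    using arc(2)[of 0] end_state assms(3) by (cases ?n) auto
  then show ?thesis
    using closed dir unfolding directed_closed_def
    by (simp add: induced_dir_def in_end_def out_end_def wedge_def tail_state_def head_state_def)
qed

section \<open>Flows along chains\<close>

text \<open>Unlike \<open>sgn\<close>, the value at 0 is 1: it is always a unit and agrees with
  \<open>flow_orient\<close>, which keeps \<omega> where \<open>f\<close> vanishes.\<close>

definition sgn1 :: "int \<Rightarrow> int" where
  "sgn1 k = (if k \<ge> 0 then 1 else - 1)"

lemma sgn1_simps: "sgn1 k * sgn1 k = 1" "sgn1 k * \<bar>k\<bar> = k" "sgn1 k * k = \<bar>k\<bar>"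
  by (auto simp: sgn1_def)

lemma flow_orient_eq: "flow_orient \<omega> f e b = sgn1 (f e) * \<omega> e b"
  by (simp add: flow_orient_def sgn1_def)

lemma orientation_flow_orient: "orientation S \<omega> \<Longrightarrow> orientation S (flow_orient \<omega> f)"
  by (fastforce simp: orientation_def flow_orient_def)

text \<open>Passes between \<omega> and its reorientation in both directions: \<bar>f\<bar> becomes
  a flow after reorienting, and edge counts of closed chains become flows for \<omega>.\<close>

lemma is_flow_sgn1:
  "is_flow S \<omega> (\<lambda>e. sgn1 (f e) * g e) \<longleftrightarrow> is_flow S (flow_orient \<omega> f) g"
  by (simp add: is_flow_def flow_orient_eq mult.assoc mult.left_commute)

lemma is_flow_cong:
  "(\<And>e. e \<in> sg_edges S \<Longrightarrow> f e = g e) \<Longrightarrow> is_flow S \<omega> f \<longleftrightarrow> is_flow S \<omega> g"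
  unfolding is_flow_def
  by (intro ball_cong refl arg_cong2[where f = "(=)"] sum.cong) (auto simp: ends_at_def)

lemma is_flow_diff: "is_flow S \<omega> f \<Longrightarrow> is_flow S \<omega> g \<Longrightarrow> is_flow S \<omega> (\<lambda>e. f e - g e)"
  unfolding is_flow_def by (simp add: right_diff_distrib sum_subtractf case_prod_unfold)

lemma edge_count_eq_card: "edge_count xs e = int (card {i. i < length xs \<and> fst (xs ! i) = e})"
  by (auto simp: count_list_eq_length_filter length_filter_conv_card intro!: arg_cong[where f = card])

text \<open>All occurrences of \<open>e\<close> are directed by the same orientation, so each
  couples with \<omega> to \<open>sgn1 (f e)\<close> and none cancel.\<close>

lemma walk_flow_flow_orient:
  assumes "orientation S \<omega>" and "e \<in> sg_edges S"
  shows "walk_flow \<omega> W (induced_dir (flow_orient \<omega> f) W) e = sgn1 (f e) * edge_count (snd W) e"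
proof -
  have "walk_flow \<omega> W (induced_dir (flow_orient \<omega> f) W) e =
      (\<Sum>i | i < wlen W \<and> wedge W i = e. sgn1 (f e))"
    unfolding walk_flow_def coupling_def induced_dir_def flow_orient_eq
    by (intro sum.cong) (auto simp: mult.left_commute orientation_unit[OF assms])
  then show ?thesis
    by (simp add: wedge_def edge_count_eq_card)
qed

text \<open>Otherwise the signed counts \<open>f1\<close> and the remainder \<open>f2\<close> split
  \<open>f\<close>: as the counts are at most \<bar>f\<bar>, both have weakly the sign of
  \<open>f\<close> on every edge.\<close>

lemma closed_chain_carries_flow:
  assumes "finite (sg_edges S)" and f: "conformally_indecomposable S \<omega> f"
    and "chain S (flow_orient \<omega> f) p xs p" and "xs \<noteq> []"
    and le: "\<And>e. e \<in> sg_edges S \<Longrightarrow> edge_count xs e \<le> \<bar>f e\<bar>"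
    and e: "e \<in> sg_edges S"
  shows "edge_count xs e = \<bar>f e\<bar>"
proof (rule ccontr)
  assume ne: "edge_count xs e \<noteq> \<bar>f e\<bar>"
  define f1 where "f1 e = sgn1 (f e) * edge_count xs e" for e
  define f2 where "f2 e = f e - f1 e" for e
  have f2: "f2 e = sgn1 (f e) * (\<bar>f e\<bar> - edge_count xs e)" for e
    by (simp add: f2_def f1_def right_diff_distrib sgn1_simps)
  have fl1: "is_flow S \<omega> f1"
    unfolding f1_def is_flow_sgn1 by (rule chain_closed_flow[OF assms(1,3)])
  have fl2: "is_flow S \<omega> f2"
    unfolding f2_def using f fl1 by (intro is_flow_diff) (auto simp: conformally_indecomposable_def)
  have "fst (hd xs) \<in> sg_edges S" "edge_count xs (fst (hd xs)) \<noteq> 0"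
    using assms(3,4) by (cases xs; simp)+
  then have n1: "nonzero_on S f1"
    by (force simp: nonzero_on_def f1_def sgn1_def)
  have n2: "nonzero_on S f2"
    using e ne unfolding nonzero_on_def f2 by (intro bexI[of _ e]) (auto simp: sgn1_def)
  have "f1 e * f2 e \<ge> 0" if "e \<in> sg_edges S" for e
    using le[OF that] by (simp add: f1_def f2 mult.left_commute mult.assoc[symmetric] sgn1_simps)
  then show False
    using f fl1 fl2 n1 n2 unfolding conformally_indecomposable_def f2_def by fastforce
qed

section \<open>Existence of a closed chain below a nonnegative flow\<close>

lemma chain_length_eq_sum:
  assumes "finite (sg_edges S)" and "chain S \<tau> p xs q"
  shows "int (length xs) = (\<Sum>e\<in>sg_edges S. edge_count xs e)"
proof -
  have "set (map fst xs) \<subseteq> sg_edges S"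
    using assms(2) by (force simp: chain_iff in_set_conv_nth)
  then show ?thesis
    using sum_count_set[OF _ assms(1), of "map fst xs"] by (simp flip: of_nat_sum)
qed

text \<open>What remains of \<open>g\<close> after subtracting the counts is unbalanced at the
  vertex of \<open>q\<close>, so some end there with sign \<open>snd q\<close> has capacity
  left.\<close>

lemma chain_extend:
  assumes "finite (sg_edges S)" and "orientation S \<tau>" and "is_flow S \<tau> g"
    and "chain S \<tau> p xs q" and "p \<noteq> q" and "fst q \<in> sg_verts S"
    and sgn: "snd p \<in> {1, -1}" "snd q \<in> {1, -1}"
    and le: "\<And>e. e \<in> sg_edges S \<Longrightarrow> edge_count xs e \<le> g e"
  obtains x where "fst x \<in> sg_edges S" and "tail_state S \<tau> x = q"
    and "edge_count xs (fst x) < g (fst x)"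
proof -
  have "(\<Sum>(e, b)\<in>ends_at S (fst q). \<tau> e b * g e) = 0"
    using assms(3,6) by (auto simp: is_flow_def)
  then have "(\<Sum>(e, b)\<in>ends_at S (fst q). snd q * \<tau> e b * (g e - edge_count xs e)) =
      - snd q * (\<Sum>(e, b)\<in>ends_at S (fst q). \<tau> e b * edge_count xs e)"
    by (simp add: right_diff_distrib sum_subtractf case_prod_unfold sum_distrib_left[symmetric] mult.assoc)
  \<comment> \<open>The value is 1 if \<open>p\<close> and \<open>q\<close> lie at different
    vertices, and 2 if they are the two states of one vertex.\<close>
  also have "\<dots> > 0"
    unfolding chain_boundary[OF assms(1,4)] using assms(5) sgn by (auto simp: prod_eq_iff)
  finally have "\<not> (\<forall>(e, b)\<in>ends_at S (fst q). snd q * \<tau> e b * (g e - edge_count xs e) \<le> 0)"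
    using sum_nonpos[of "ends_at S (fst q)" "\<lambda>(e, b). snd q * \<tau> e b * (g e - edge_count xs e)"]
    by fastforce
  then obtain e b where eb: "(e, b) \<in> ends_at S (fst q)"
    and pos: "snd q * \<tau> e b * (g e - edge_count xs e) > 0"
    by auto
  have e: "e \<in> sg_edges S" "sg_end S e b = fst q"
    using eb by (auto simp: ends_at_def)
  have lt: "edge_count xs e < g e"
    using pos le[OF e(1)] by (cases "g e = edge_count xs e") auto
  then have "snd q * \<tau> e b > 0"
    using pos by (simp add: zero_less_mult_iff)
  then have "\<tau> e b = snd q"
    using assms(2) sgn(2) e(1) unfolding orientation_def by force
  with e lt show thesis
    by (intro that[of "(e, b)"]) (auto simp: tail_state_def)
qed

lemma chain_head_state:
  assumes "signed_graph S" and "orientation S \<tau>" and "fst x \<in> sg_edges S"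
  shows "fst (head_state S \<tau> x) \<in> sg_verts S" and "snd (head_state S \<tau> x) \<in> {1, -1}"
    and "snd (tail_state S \<tau> x) \<in> {1, -1}"
  using assms unfolding signed_graph_def orientation_def head_state_def tail_state_def
  by fastforce+

lemma closed_chain_exists:
  assumes S: "signed_graph S" and \<tau>: "orientation S \<tau>" and g: "is_flow S \<tau> g"
    and nonneg: "\<And>e. e \<in> sg_edges S \<Longrightarrow> g e \<ge> 0" and "nonzero_on S g"
  obtains p xs where "chain S \<tau> p xs p" and "xs \<noteq> []"
    and "\<And>e. e \<in> sg_edges S \<Longrightarrow> edge_count xs e \<le> g e"
proof -
  have fin: "finite (sg_edges S)"
    using S by (simp add: signed_graph_def)
  define P where "P n \<longleftrightarrow> (\<exists>p xs q. chain S \<tau> p xs q \<and> xs \<noteq> [] \<and> length xs = n \<and>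
    (\<forall>e\<in>sg_edges S. edge_count xs e \<le> g e))" for n
  obtain e0 where e0: "e0 \<in> sg_edges S" "g e0 \<noteq> 0"
    using assms(5) by (auto simp: nonzero_on_def)
  \<comment> \<open>One step along \<open>e0\<close> starts the maximisation; the choice of end is
    arbitrary, and \<open>g e0\<close> is at least 1.\<close>
  have "chain S \<tau> (tail_state S \<tau> (e0, True)) [(e0, True)] (head_state S \<tau> (e0, True))"
    using e0 by simp
  moreover have "\<forall>e\<in>sg_edges S. edge_count [(e0, True)] e \<le> g e"
    using nonneg e0 by force
  ultimately have "P 1"
    unfolding P_def by (metis One_nat_def length_Cons list.distinct(1) list.size(3))
  moreover have "\<forall>n. P n \<longrightarrow> n \<le> nat (\<Sum>e\<in>sg_edges S. g e)"
  proof (intro allI impI)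
    fix n assume "P n"
    then obtain p xs q where c: "chain S \<tau> p xs q" "length xs = n"
      and le: "\<forall>e\<in>sg_edges S. edge_count xs e \<le> g e"
      by (auto simp: P_def)
    \<comment> \<open>A chain has as many steps as its total edge count, so the capacities bound the
      length and a maximal \<open>n\<close> exists.\<close>
    have "int n \<le> (\<Sum>e\<in>sg_edges S. g e)"
      using chain_length_eq_sum[OF fin c(1)] c(2) le by (simp add: sum_mono)
    then show "n \<le> nat (\<Sum>e\<in>sg_edges S. g e)" by simp
  qed
  ultimately obtain n where n: "P n" "\<And>m. P m \<Longrightarrow> m \<le> n"
    using Greatest_le_nat GreatestI_nat by metis
  from n(1) obtain p xs q where c: "chain S \<tau> p xs q" and ne: "xs \<noteq> []" and len: "length xs = n"
    and le: "\<And>e. e \<in> sg_edges S \<Longrightarrow> edge_count xs e \<le> g e"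
    unfolding P_def by blast
  have "p = q"
  proof (rule ccontr)
    assume "p \<noteq> q"
    obtain m where m: "length xs = Suc m"
      using ne by (cases "length xs") auto
    have p: "p = tail_state S \<tau> (xs ! 0)" "fst (xs ! 0) \<in> sg_edges S"
      and q: "q = head_state S \<tau> (xs ! m)" "fst (xs ! m) \<in> sg_edges S"
      using c m unfolding chain_iff by auto
    obtain x where x: "fst x \<in> sg_edges S" "tail_state S \<tau> x = q"
      "edge_count xs (fst x) < g (fst x)"
      using chain_extend[OF fin \<tau> g c \<open>p \<noteq> q\<close> _ _ _ le] chain_head_state[OF S \<tau>] p q by metis
    have "chain S \<tau> p (xs @ [x]) (head_state S \<tau> x)"
      using c x by (intro chain_append[THEN iffD2] exI[of _ q]) simp
    moreover have "\<forall>e\<in>sg_edges S. edge_count (xs @ [x]) e \<le> g e"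
      using le x by auto
    ultimately have "P (Suc n)"
      unfolding P_def using len by (metis length_append_singleton snoc_eq_iff_butlast)
    then show False
      using n(2) by force
  qed
  with c ne le show thesis
    using that by blast
qed

text \<open>Excising the steps between two equal states leaves a closed chain, which by
  \<open>closed_chain_carries_flow\<close> already exhausts every edge; nothing is left for the
  excised steps.\<close>

lemma closed_chain_states_inj:
  assumes fin: "finite (sg_edges S)" and f: "conformally_indecomposable S \<omega> f"
    and c: "chain S (flow_orient \<omega> f) p xs p"
    and le: "\<And>e. e \<in> sg_edges S \<Longrightarrow> edge_count xs e \<le> \<bar>f e\<bar>"
  shows "inj_on (state_at S (flow_orient \<omega> f) p xs) {..<length xs}"
proof (rule linorder_inj_onI)
  let ?\<tau> = "flow_orient \<omega> f" and ?st = "state_at S (flow_orient \<omega> f) p xs"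
  fix i j assume ij: "i < j" "i \<in> {..<length xs}" "j \<in> {..<length xs}"
  show "?st i \<noteq> ?st j"
  proof
    assume eq: "?st i = ?st j"
    let ?ys = "take i xs @ drop j xs"
    have xs: "xs = take i xs @ take (j - i) (drop i xs) @ drop j xs"
      using ij by (metis append.assoc append_take_drop_id le_add_diff_inverse less_imp_le take_add)
    have "chain S ?\<tau> p (take i xs) (?st i)" "chain S ?\<tau> (?st j) (drop j xs) p"
      using ij by (auto intro: chain_split c)
    then have ys: "chain S ?\<tau> p ?ys p"
      unfolding chain_append using eq by metis
    have count: "edge_count xs e = edge_count ?ys e + edge_count (take (j - i) (drop i xs)) e" for e
      by (subst xs) simp
    have "edge_count ?ys e \<le> \<bar>f e\<bar>" if "e \<in> sg_edges S" for e
      using le[OF that] count[of e] by linarith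
    \<comment> \<open>\<open>?ys\<close> is nonempty because \<open>j < length xs\<close>; the final
      state, which equals the first, lies outside the index range.\<close>
    then have "edge_count ?ys e = \<bar>f e\<bar>" if "e \<in> sg_edges S" for e
      using ij that by (intro closed_chain_carries_flow[OF fin f ys]) auto
    then have zero: "edge_count (take (j - i) (drop i xs)) e = 0" if "e \<in> sg_edges S" for e
      using le count that by fastforce
    have "xs ! i \<in> set (take (j - i) (drop i xs))"
      using ij by (auto simp: in_set_conv_nth intro!: exI[of _ 0])
    moreover have "fst (xs ! i) \<in> sg_edges S"
      using c ij unfolding chain_iff by auto
    ultimately show False
      using zero by (force simp: count_list_0_iff)
  qed
qed auto

section \<open>Circles\<close>

lemma wvert_Pair_append:
  "wvert S (u, xs @ ys) i =
     (if i \<le> length xs then wvert S (u, xs) i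
      else wvert S (wvert S (u, xs) (length xs), ys) (i - length xs))"
proof (cases i)
  case (Suc j)
  then show ?thesis
    by (cases "Suc j \<le> length xs")
      (auto simp: wedge_def in_end_def out_end_def nth_append Suc_diff_le)
qed simp

lemma is_walk_append:
  assumes "is_walk S (u, xs)" and "is_walk S (wvert S (u, xs) (length xs), ys)"
  shows "is_walk S (u, xs @ ys)"
    and "wvert S (u, xs @ ys) (length (xs @ ys)) =
      wvert S (wvert S (u, xs) (length xs), ys) (length ys)"
proof -
  show "is_walk S (u, xs @ ys)"
    unfolding is_walk_def
  proof (intro conjI allI impI)
    fix i assume i: "i < wlen (u, xs @ ys)"
    show "wedge (u, xs @ ys) i \<in> sg_edges S"
      and "sg_end S (wedge (u, xs @ ys) i) (out_end (u, xs @ ys) i) = wvert S (u, xs @ ys) i"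
      using assms i unfolding is_walk_def wvert_Pair_append
      by (cases "i < length xs"; force simp: wedge_def out_end_def nth_append)+
  qed (use assms(1) in \<open>simp add: is_walk_def\<close>)
qed (simp add: wvert_Pair_append)

lemma wvert_drop:
  "j \<le> length xs - i \<Longrightarrow> i \<le> length xs \<Longrightarrow>
     wvert S (wvert S (u, xs) i, drop i xs) j = wvert S (u, xs) (i + j)"
  by (cases j) (auto simp: wedge_def in_end_def out_end_def)

lemma wvert_take: "i \<le> j \<Longrightarrow> wvert S (u, take j xs) i = wvert S (u, xs) i"
  by (cases i) (auto simp: wedge_def in_end_def out_end_def)

text \<open>From vertex \<open>i\<close> follow the walk to its end, which is its start, and go on
  from there to vertex \<open>j\<close>.\<close>

lemma connected_closed_walk:
  assumes W: "closed_walk S W"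
  shows "connected_graph (walk_subgraph S W)"
proof -
  let ?H = "walk_subgraph S W"
  obtain u xs where uxs: "W = (u, xs)" by (cases W)
  let ?n = "length xs"
  have vH: "wvert ?H = wvert S"
  proof (intro ext)
    fix X i show "wvert ?H X i = wvert S X i"
      by (cases i) (simp_all add: walk_subgraph_def)
  qed
  have arc: "sg_end S (wedge W i) (out_end W i) = wvert S W i" if "i < ?n" for i
    using W that uxs unfolding closed_walk_def is_walk_def by auto
  have closed: "wvert S W ?n = wvert S W 0"
    using W uxs unfolding closed_walk_def by auto
  have prefix: "is_walk ?H (u, take i xs)" "wvert S (u, take i xs) (length (take i xs)) = wvert S W i"
    if "i \<le> ?n" for i
    using that arc uxs unfolding is_walk_def vH
    by (force simp: walk_subgraph_def wvert_take wedge_def out_end_def)+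
  have suffix: "is_walk ?H (wvert S W i, drop i xs)"
    "wvert S (wvert S W i, drop i xs) (length (drop i xs)) = u" if "i \<le> ?n" for i
  proof -
    show "is_walk ?H (wvert S W i, drop i xs)"
      unfolding is_walk_def vH
    proof (intro conjI allI impI)
      fix j assume "j < wlen (wvert S W i, drop i xs)"
      then have j: "i + j < ?n" by simp
      then have "wedge W (i + j) \<in> sg_edges ?H"
        using uxs by (auto simp: walk_subgraph_def)
      then show "wedge (wvert S W i, drop i xs) j \<in> sg_edges ?H"
        using uxs that by (simp add: wedge_def)
      show "sg_end ?H (wedge (wvert S W i, drop i xs) j) (out_end (wvert S W i, drop i xs) j) =
          wvert S (wvert S W i, drop i xs) j"
        using arc[OF j] uxs that j
        by (simp add: wvert_drop wedge_def out_end_def walk_subgraph_def)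
    qed (use uxs that in \<open>auto simp: walk_subgraph_def\<close>)
    show "wvert S (wvert S W i, drop i xs) (length (drop i xs)) = u"
      using closed uxs that by (simp add: wvert_drop)
  qed
  have "\<exists>X. is_walk ?H X \<and> wvert ?H X 0 = wvert S W i \<and> wvert ?H X (wlen X) = wvert S W j"
    if "i \<le> ?n" "j \<le> ?n" for i j
    using is_walk_append[of ?H "wvert S W i" "drop i xs" "take j xs"]
      suffix[OF that(1)] prefix[OF that(2)]
    by (intro exI[of _ "(wvert S W i, drop i xs @ take j xs)"]) (simp add: vH)
  then show ?thesis
    unfolding connected_graph_def using uxs by (auto simp: walk_subgraph_def)
qed

text \<open>
  All steps start with the same sign \<open>c\<close>, so that \<open>\<rho>\<close> tells the ends through which the walk leaves
  a vertex from those through which it arrives.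
\<close>

lemma circle_walk_of_chain:
  assumes c: "chain T \<rho> (u, c) xs (u, c)" and "c \<noteq> 0" and "xs \<noteq> []" and "u \<in> sg_verts T"
    and snd: "\<And>i. i \<le> length xs \<Longrightarrow> snd (state_at T \<rho> (u, c) xs i) = c"
    and inj: "inj_on (wvert T (u, xs)) {..<length xs}"
  shows "circle_walk T (u, xs)"
proof -
  let ?W = "(u, xs)" and ?n = "length xs"
  let ?H = "walk_subgraph T ?W"
  have v: "wvert T ?W i = fst (state_at T \<rho> (u, c) xs i)" for i
    using wvert_eq_state_at[of T "(u, c)" xs i \<rho>] by simp
  have arc: "fst (xs ! i) \<in> sg_edges T"
    "state_at T \<rho> (u, c) xs i = tail_state T \<rho> (xs ! i)" if "i < ?n" for i
    using c that unfolding chain_iff by auto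
  have out: "sg_end T (fst (xs ! i)) (snd (xs ! i)) = wvert T ?W i"
    "\<rho> (fst (xs ! i)) (snd (xs ! i)) = c" if "i < ?n" for i
    using arc(2)[OF that] snd[of i] that by (simp_all add: v tail_state_def)
  have inn: "sg_end T (fst (xs ! i)) (\<not> snd (xs ! i)) = wvert T ?W (Suc i)"
    "\<rho> (fst (xs ! i)) (\<not> snd (xs ! i)) = - c" if "i < ?n" for i
    using that snd[of "Suc i"] unfolding v by (auto simp: head_state_def)
  have closed: "closed_walk T ?W"
    using c assms(3,4) arc(1) out(1) unfolding closed_walk_def is_walk_def
    by (auto simp: wedge_def out_end_def chain_iff v)
  then have v_n: "wvert T ?W ?n = wvert T ?W 0"
    by (simp add: closed_walk_def)
  have "inj_on (wedge ?W) {..<?n}"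
  proof (rule inj_onI)
    fix i j assume ij: "i \<in> {..<?n}" "j \<in> {..<?n}" and eq: "wedge ?W i = wedge ?W j"
    have e: "fst (xs ! i) = fst (xs ! j)"
      using eq by (simp add: wedge_def)
    \<comment> \<open>If the edge were traversed in opposite ways, one end of it would have both
      signs \<open>c\<close> and \<open>- c\<close>.\<close>
    have "snd (xs ! i) = snd (xs ! j)"
      using out(2)[of i] inn(2)[of j] ij e \<open>c \<noteq> 0\<close> by (cases "snd (xs ! i)"; cases "snd (xs ! j)") auto
    then have "wvert T ?W i = wvert T ?W j"
      using out(1)[of i] out(1)[of j] ij e by simp
    then show "i = j"
      using inj ij by (auto dest: inj_onD)
  qed
  moreover have "card (ends_at ?H (wvert T ?W i)) = 2" if i: "i < ?n" for i
  proof -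
    \<comment> \<open>\<open>k\<close> is the step arriving at vertex \<open>i\<close>, with indices
      read cyclically.\<close>
    define k where "k = (if i = 0 then ?n - 1 else i - 1)"
    have k: "k < ?n" "wvert T ?W (Suc k) = wvert T ?W i"
      using i v_n by (auto simp: k_def simp del: wvert.simps)
    \<comment> \<open>\<open>Suc j\<close> may reach \<open>?n\<close>, outside the range of
      \<open>inj\<close>; that vertex is vertex 0 and is treated apart.\<close>
    have k_uniq: "j = k" if j: "j < ?n" "wvert T ?W (Suc j) = wvert T ?W i" for j
    proof (cases "Suc j = ?n")
      case True
      then have "i = 0"
        using j(2) v_n inj i by (auto dest!: inj_onD[of _ _ 0 i])
      then show ?thesis
        using True by (simp add: k_def)
    next
      case False
      then have "Suc j = i"
        using j inj i by (auto dest: inj_onD simp del: wvert.simps)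
      then show ?thesis
        by (auto simp: k_def)
    qed
    have "ends_at ?H (wvert T ?W i) = {xs ! i, (fst (xs ! k), \<not> snd (xs ! k))}"
    proof (intro equalityI subsetI)
      fix x assume "x \<in> ends_at ?H (wvert T ?W i)"
      then obtain j where j: "j < ?n" "fst x = fst (xs ! j)"
        "sg_end T (fst x) (snd x) = wvert T ?W i"
        by (auto simp: ends_at_def walk_subgraph_def wedge_def)
      show "x \<in> {xs ! i, (fst (xs ! k), \<not> snd (xs ! k))}"
      proof (cases "snd x = snd (xs ! j)")
        case True
        then have "j = i"
          using j out(1)[of j] inj i by (auto dest: inj_onD)
        then show ?thesis
          using True j by (simp add: prod_eq_iff)
      next
        case False
        then have "snd x = (\<not> snd (xs ! j))" by blast
        moreover from this have "j = k"
          using j inn(1)[of j] k_uniq by simp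
        ultimately show ?thesis
          using j by (simp add: prod_eq_iff)
      qed
    next
      fix x assume "x \<in> {xs ! i, (fst (xs ! k), \<not> snd (xs ! k))}"
      then show "x \<in> ends_at ?H (wvert T ?W i)"
        using k(2) imageI[of i "{..<?n}" "wedge ?W"] imageI[of k "{..<?n}" "wedge ?W"]
          out(1)[OF i] inn(1)[OF k(1)] i k(1)
        by (auto simp: ends_at_def walk_subgraph_def wedge_def case_prod_unfold simp del: wvert.simps)
    qed
    \<comment> \<open>The ends differ even when \<open>k = i\<close>, for a single loop, since
      \<rho> is \<open>c\<close> on one and \<open>- c\<close> on the other.\<close>
    moreover have "xs ! i \<noteq> (fst (xs ! k), \<not> snd (xs ! k))"
      using out(2)[OF i] inn(2)[OF k(1)] \<open>c \<noteq> 0\<close> by auto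
    ultimately show ?thesis by simp
  qed
  moreover have "sg_verts ?H \<subseteq> wvert T ?W ` {..<?n}"
  proof
    fix w assume "w \<in> sg_verts ?H"
    then obtain i where "i \<le> ?n" "w = wvert T ?W i"
      by (auto simp: walk_subgraph_def)
    then show "w \<in> wvert T ?W ` {..<?n}"
      using v_n assms(3) by (cases "i = ?n") (auto simp del: wvert.simps intro!: imageI)
  qed
  ultimately show ?thesis
    using closed connected_closed_walk[OF closed]
    unfolding circle_walk_def is_circle_def by (auto simp del: wvert.simps)
qed

section \<open>The double cover\<close>

lemma double_cover_simps [simp]:
  "sg_verts (double_cover S) = sg_verts S \<times> {1, -1}"
  "sg_edges (double_cover S) = sg_edges S \<times> {1, -1}"
  "sg_sign (double_cover S) e' = 1"
  by (simp_all add: double_cover_def)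

lemma sg_end_double_cover:
  "sg_end (double_cover S) e' b = (sg_end S (fst e') b, end_level S e' b)"
  by (cases e') (simp add: double_cover_def end_level_def)

lemma end_level_eq: "end_level S e' b = (if b then snd e' * sg_sign S (fst e') else snd e')"
  by (cases e') (simp add: double_cover_def end_level_def)

lemma end_level_unit:
  assumes "signed_graph S" and "e' \<in> sg_edges (double_cover S)"
  shows "end_level S e' b \<in> {1, -1}"
  using assms unfolding end_level_eq signed_graph_def by fastforce

text \<open>The levels of the two ends of a lifted edge multiply to the sign \<sigma> of the edge
  below, the values of \<omega> to -\<sigma>; so the lifted values multiply to -1, as a positive
  edge requires.\<close>

lemma orientation_lift_orient:
  assumes "signed_graph S" and "orientation S \<omega>"
  shows "orientation (double_cover S) (lift_orient S \<omega>)"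
  unfolding orientation_def
proof (intro ballI conjI allI)
  fix e' b assume e': "e' \<in> sg_edges (double_cover S)"
  have \<omega>: "\<omega> (fst e') b \<in> {1, -1}" "sg_sign S (fst e') = - (\<omega> (fst e') False * \<omega> (fst e') True)" for b
    using e' assms(2) unfolding orientation_def by (auto simp: mem_Times_iff)
  show "lift_orient S \<omega> e' b \<in> {1, -1}"
    using end_level_unit[OF assms(1) e', of b] \<omega>(1)[of b] by (auto simp: lift_orient_def)
  have "snd e' \<in> {1, -1}"
    using e' by auto
  then show "sg_sign (double_cover S) e' = - (lift_orient S \<omega> e' False * lift_orient S \<omega> e' True)"
    using \<omega>(1)[of False] \<omega>(1)[of True] \<omega>(2) by (auto simp: lift_orient_def end_level_eq)
qed

text \<open>Lets the results on \<open>flow_orient\<close> apply in the double cover, where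
  \<open>f \<circ> fst\<close> serves to carry the signs of \<open>f\<close>.\<close>

lemma lift_orient_flow_orient:
  "lift_orient S (flow_orient \<omega> f) = flow_orient (lift_orient S \<omega>) (f \<circ> fst)"
  by (intro ext) (simp add: lift_orient_def flow_orient_eq)

text \<open>Passing an edge multiplies level and state sign alike by the sign of the edge, so their
  product \<open>c\<close> is constant; it is also the sign of every lifted state. Thus a vertex of
  the lift records a state below.\<close>

lemma lift_chain:
  assumes \<tau>: "orientation S \<tau>" and c: "chain S \<tau> p xs p" and ne: "xs \<noteq> []"
    and W': "walk_lift S (fst p, xs) W'"
  obtains c where "c \<in> {1, -1}"
    and "chain (double_cover S) (lift_orient S \<tau>) (fst W', c) (snd W') (fst W', c)"
    and "\<And>i. i \<le> length xs \<Longrightarrow>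
      state_at (double_cover S) (lift_orient S \<tau>) (fst W', c) (snd W') i =
        ((fst (state_at S \<tau> p xs i), c * snd (state_at S \<tau> p xs i)), c)"
proof -
  let ?W = "(fst p, xs)" and ?n = "length xs" and ?D = "double_cover S" and ?\<rho> = "lift_orient S \<tau>"
  let ?st = "state_at S \<tau> p xs"
  obtain \<alpha> where \<alpha>0: "\<alpha> 0 \<in> {1, -1}"
    and \<alpha>: "\<And>i. i < ?n \<Longrightarrow> \<alpha> (Suc i) = \<alpha> i * sg_sign S (fst (xs ! i))"
    and v: "\<And>i. i \<le> ?n \<Longrightarrow> wvert ?D W' i = (fst (?st i), \<alpha> i)"
    using W' unfolding walk_lift_def by (auto simp: wvert_eq_state_at[of _ _ _ _ \<tau>] wedge_def)
  have wl: "is_walk ?D W'" "wlen W' = ?n"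
    "\<And>i. i < ?n \<Longrightarrow> fst (fst (snd W' ! i)) = fst (xs ! i) \<and> snd (snd W' ! i) = snd (xs ! i)"
    using W' unfolding walk_lift_def by (auto simp: wedge_def out_end_def)
  have arc: "fst (xs ! i) \<in> sg_edges S" "tail_state S \<tau> (xs ! i) = ?st i" if "i < ?n" for i
    using c that unfolding chain_iff by auto
  have p: "snd p \<in> {1, -1}"
    using chain_state_sign[OF \<tau> c ne, of 0] by simp
  define c where "c = \<alpha> 0 * snd p"
  have c_unit: "c \<in> {1, -1}"
    using \<alpha>0 p by (auto simp: c_def)
  have const: "\<alpha> i * snd (?st i) = c" if "i \<le> ?n" for i
    using that
  proof (induction i)
    case (Suc i)
    let ?e = "fst (xs ! i)" and ?b = "snd (xs ! i)"
    have "sg_sign S ?e = - (\<tau> ?e ?b * \<tau> ?e (\<not> ?b))" "\<tau> ?e (\<not> ?b) \<in> {1, -1}"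
      using \<tau> arc(1)[of i] Suc.prems unfolding orientation_def by (cases ?b; auto)+
    moreover have "snd (?st i) = \<tau> ?e ?b"
      using arc(2)[of i] Suc.prems by (simp add: tail_state_def prod_eq_iff)
    ultimately show ?case
      using \<alpha>[of i] Suc by (auto simp: head_state_def)
  qed (simp add: c_def)
  have \<alpha>_eq: "\<alpha> i = c * snd (?st i)" if "i \<le> ?n" for i
    using const[OF that] chain_state_sign[OF \<tau> c ne that] by auto
  have st: "state_at ?D ?\<rho> (fst W', c) (snd W') i = (wvert ?D W' i, c)" if "i \<le> ?n" for i
  proof (cases i)
    case (Suc j)
    let ?x = "snd W' ! j"
    have end_eq: "sg_end ?D (fst ?x) (\<not> snd ?x) = wvert ?D W' i"
      using Suc by (simp add: wedge_def in_end_def out_end_def)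
    then have "end_level S (fst ?x) (\<not> snd ?x) = \<alpha> i"
      using v[OF that] by (simp add: sg_end_double_cover)
    then have "- ?\<rho> (fst ?x) (\<not> snd ?x) = \<alpha> i * snd (?st i)"
      using wl(3)[of j] Suc that by (simp add: lift_orient_def head_state_def)
    then show ?thesis
      using end_eq const[OF that] Suc by (simp add: head_state_def)
  qed simp
  \<comment> \<open>The chain returns to its initial state, not only to its initial vertex, so the
    level returns too.\<close>
  have "wvert ?D W' ?n = wvert ?D W' 0"
    using v[of ?n] v[of 0] \<alpha>_eq[of ?n] \<alpha>_eq[of 0] c by (simp add: chain_iff)
  then have "state_at ?D ?\<rho> (fst W', c) (snd W') (wlen W') = (fst W', c)"
    using st[of ?n] wl(2) by simp
  moreover have "fst (snd W' ! i) \<in> sg_edges ?D \<and>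
      tail_state ?D ?\<rho> (snd W' ! i) = state_at ?D ?\<rho> (fst W', c) (snd W') i" if "i < wlen W'" for i
  proof -
    let ?x = "snd W' ! i"
    have i: "i < ?n" "i \<le> ?n" using that wl(2) by auto
    have x: "fst ?x \<in> sg_edges ?D" "sg_end ?D (fst ?x) (snd ?x) = wvert ?D W' i"
      using wl(1) that unfolding is_walk_def wedge_def out_end_def by auto
    then have "end_level S (fst ?x) (snd ?x) = \<alpha> i"
      using v[OF i(2)] by (simp add: sg_end_double_cover)
    moreover have "snd (?st i) = \<tau> (fst (xs ! i)) (snd (xs ! i))"
      using arc(2)[OF i(1)] by (simp add: tail_state_def prod_eq_iff)
    ultimately have "?\<rho> (fst ?x) (snd ?x) = c"
      using const[OF i(2)] wl(3)[OF i(1)] by (simp add: lift_orient_def)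
    then show ?thesis
      using x st[OF i(2)] by (simp add: tail_state_def)
  qed
  ultimately have "chain ?D ?\<rho> (fst W', c) (snd W') (fst W', c)"
    unfolding chain_iff by blast
  with c_unit show thesis
    using st v \<alpha>_eq by (intro that) auto
qed

text \<open>Lifting the direction occurrence by occurrence agrees with restricting the lifted
  orientation, so \<open>walk_flow_flow_orient\<close> becomes available for the lift.\<close>

lemma walk_flow_lift_dir:
  assumes "walk_lift S W W'"
  shows "walk_flow \<rho> W' (lift_dir S W' (induced_dir \<tau> W)) = walk_flow \<rho> W' (induced_dir (lift_orient S \<tau>) W')"
  using assms unfolding walk_flow_def walk_lift_def
  by (intro ext sum.cong) (auto simp: lift_dir_def induced_dir_def lift_orient_def)

lemma edge_count_lift:
  assumes "walk_lift S W W'"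
  shows "edge_count (snd W') (e, 1) + edge_count (snd W') (e, -1) = edge_count (snd W) e"
proof -
  let ?A = "\<lambda>\<beta>. {i. i < wlen W' \<and> fst (snd W' ! i) = (e, \<beta>)}"
  have "snd (fst (snd W' ! i)) \<in> {1, -1}" if "i < wlen W'" for i
    using assms that unfolding walk_lift_def is_walk_def wedge_def by (auto simp: mem_Times_iff)
  then have "{i. i < wlen W \<and> fst (snd W ! i) = e} = ?A 1 \<union> ?A (-1)"
    using assms unfolding walk_lift_def wedge_def by (fastforce simp: prod_eq_iff)
  moreover have "card (?A 1 \<union> ?A (-1)) = card (?A 1) + card (?A (-1))"
    by (rule card_Un_disjoint) auto
  ultimately show ?thesis
    unfolding edge_count_eq_card by simp
qed

text \<open>On a fixed level the lifted orientation differs from \<omega> only by the common factor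
  \<alpha>, which cancels from the balance; adding both levels over \<open>v\<close> gives the
  balance of the projection.\<close>

lemma is_flow_proj:
  assumes S: "signed_graph S" and f': "is_flow (double_cover S) (lift_orient S \<omega>) f'"
  shows "is_flow S \<omega> (proj_fun f')"
  unfolding is_flow_def
proof
  let ?D = "double_cover S"
  fix v assume v: "v \<in> sg_verts S"
  have fin: "finite (sg_edges S)"
    using S by (simp add: signed_graph_def)
  then have finD: "finite (ends_at ?D x)" for x
    by (intro finite_ends_at) simp
  define F where "F = (\<lambda>((e, \<beta>), b). \<omega> e b * f' (e, \<beta>))"
  have level: "(\<Sum>x\<in>ends_at ?D (v, \<alpha>). F x) = 0" if "\<alpha> \<in> {1, -1}" for \<alpha>
  proof -
    have "(\<Sum>x\<in>ends_at ?D (v, \<alpha>). \<alpha> * F x) =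
        (\<Sum>(e', b)\<in>ends_at ?D (v, \<alpha>). lift_orient S \<omega> e' b * f' e')"
      by (intro sum.cong) (auto simp: ends_at_def F_def lift_orient_def sg_end_double_cover)
    also have "\<dots> = 0"
      using f' v that by (auto simp: is_flow_def)
    finally show ?thesis
      using that by (simp add: sum_distrib_left[symmetric] del: double_cover_simps) auto
  qed
  \<comment> \<open>Regroups the lifted ends over \<open>v\<close>: an end at \<open>v\<close>
    together with a choice \<beta> of the lifted edge lies at exactly one of the two levels.\<close>
  let ?g = "\<lambda>((e :: 'b, b :: bool), \<beta> :: int). ((e, \<beta>), b)"
  have un: "ends_at ?D (v, 1) \<union> ends_at ?D (v, -1) = ?g ` (ends_at S v \<times> {1, -1})"
    (is "?L = ?R")
  proof (intro equalityI subsetI)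
    fix x assume "x \<in> ?L"
    then show "x \<in> ?R"
      by (cases x) (auto simp: ends_at_def sg_end_double_cover image_iff)
  next
    fix x assume "x \<in> ?R"
    then obtain e b \<beta> where x: "x = ((e, \<beta>), b)" "(e, b) \<in> ends_at S v" "\<beta> \<in> {1, -1}"
      by auto
    then have "end_level S (e, \<beta>) b \<in> {1, -1}"
      by (intro end_level_unit[OF S]) (auto simp: ends_at_def)
    with x show "x \<in> ?L"
      by (auto simp: ends_at_def sg_end_double_cover)
  qed
  have "(\<Sum>(e, b)\<in>ends_at S v. \<omega> e b * proj_fun f' e) =
      (\<Sum>x\<in>ends_at S v. \<Sum>\<beta>\<in>{1, -1}. F (?g (x, \<beta>)))"
    by (intro sum.cong) (auto simp: F_def proj_fun_def distrib_left)
  also have "\<dots> = (\<Sum>z\<in>ends_at S v \<times> {1, -1}. F (?g z))"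
    unfolding sum.cartesian_product by (intro sum.cong) auto
  also have "\<dots> = (\<Sum>x\<in>?g ` (ends_at S v \<times> {1, -1}). F x)"
    by (subst sum.reindex) (auto simp: inj_on_def)
  also have "\<dots> = (\<Sum>x\<in>ends_at ?D (v, 1). F x) + (\<Sum>x\<in>ends_at ?D (v, -1). F x)"
    unfolding un[symmetric] using finD by (intro sum.union_disjoint) (auto simp: ends_at_def)
  finally show "(\<Sum>(e, b)\<in>ends_at S v. \<omega> e b * proj_fun f' e) = 0"
    using level by simp
qed

text \<open>
  On both lifts of \<open>e\<close> the summands of a conformal decomposition of \<open>f'\<close> have the sign of \<open>f(e)\<close>,
  so nothing cancels under projection.
\<close>

lemma conformally_indecomposable_lift:
  assumes S: "signed_graph S" and f: "conformally_indecomposable S \<omega> f"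
    and f': "flow_lift S \<omega> f f'"
    and sgn: "\<And>e \<beta>. e \<in> sg_edges S \<Longrightarrow> \<beta> \<in> {1, -1} \<Longrightarrow> sgn1 (f e) * f' (e, \<beta>) \<ge> 0"
  shows "conformally_indecomposable (double_cover S) (lift_orient S \<omega>) f'"
  unfolding conformally_indecomposable_def
proof (intro conjI notI)
  let ?D = "double_cover S" and ?\<rho> = "lift_orient S \<omega>"
  have proj: "f' (e, 1) + f' (e, -1) = f e" if "e \<in> sg_edges S" for e
    using f' that by (auto simp: flow_lift_def proj_fun_def)
  show "is_flow ?D ?\<rho> f'"
    using f' by (simp add: flow_lift_def)
  obtain e where e: "e \<in> sg_edges S" "f e \<noteq> 0"
    using f by (auto simp: conformally_indecomposable_def nonzero_on_def)
  then have "f' (e, 1) \<noteq> 0 \<or> f' (e, -1) \<noteq> 0"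
    using proj[OF e(1)] by auto
  then show "nonzero_on ?D f'"
    using e by (auto simp: nonzero_on_def)
  assume "\<exists>f1 f2. is_flow ?D ?\<rho> f1 \<and> nonzero_on ?D f1 \<and> is_flow ?D ?\<rho> f2 \<and> nonzero_on ?D f2 \<and>
    (\<forall>e\<in>sg_edges ?D. f' e = f1 e + f2 e) \<and> (\<forall>e\<in>sg_edges ?D. 0 \<le> f1 e * f2 e)"
  then obtain f1 f2 where fl: "is_flow ?D ?\<rho> f1" "is_flow ?D ?\<rho> f2"
    and nz: "nonzero_on ?D f1" "nonzero_on ?D f2"
    and add: "\<And>e. e \<in> sg_edges ?D \<Longrightarrow> f' e = f1 e + f2 e"
    and conf: "\<And>e. e \<in> sg_edges ?D \<Longrightarrow> 0 \<le> f1 e * f2 e"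
    by blast
  \<comment> \<open>Summands of weakly equal sign take the weak sign of their sum; where
    \<open>f'\<close> vanishes, both are 0.\<close>
  have pos: "sgn1 (f e) * f1 (e, \<beta>) \<ge> 0 \<and> sgn1 (f e) * f2 (e, \<beta>) \<ge> 0"
    if "e \<in> sg_edges S" "\<beta> \<in> {1, -1}" for e \<beta>
  proof -
    have "f' (e, \<beta>) = f1 (e, \<beta>) + f2 (e, \<beta>)" "0 \<le> f1 (e, \<beta>) * f2 (e, \<beta>)"
      using that by (auto intro: add conf)
    then show ?thesis
      using sgn[OF that] by (auto simp: sgn1_def zero_le_mult_iff split: if_splits)
  qed
  have nz_proj: "nonzero_on S (proj_fun g)"
    if g: "nonzero_on ?D g"
      and pos: "\<And>e \<beta>. e \<in> sg_edges S \<Longrightarrow> \<beta> \<in> {1, -1} \<Longrightarrow> sgn1 (f e) * g (e, \<beta>) \<ge> 0" for g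
  proof -
    obtain e \<beta> where e: "e \<in> sg_edges S" "\<beta> \<in> {1, -1}" "g (e, \<beta>) \<noteq> 0"
      using g by (auto simp: nonzero_on_def)
    then have "proj_fun g e \<noteq> 0"
      using pos[OF e(1), of 1] pos[OF e(1), of "-1"]
      by (auto simp: proj_fun_def sgn1_def split: if_splits)
    with e(1) show ?thesis
      by (auto simp: nonzero_on_def)
  qed
  have "f e = proj_fun f1 e + proj_fun f2 e" "proj_fun f1 e * proj_fun f2 e \<ge> 0"
    if e: "e \<in> sg_edges S" for e
  proof -
    show "f e = proj_fun f1 e + proj_fun f2 e"
      using proj[OF e] add[of "(e, 1)"] add[of "(e, -1)"] e by (simp add: proj_fun_def)
    show "proj_fun f1 e * proj_fun f2 e \<ge> 0"
      using pos[OF e, of 1] pos[OF e, of "-1"]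
      by (auto simp: proj_fun_def sgn1_def zero_le_mult_iff split: if_splits)
  qed
  then show False
    using f is_flow_proj[OF S fl(1)] is_flow_proj[OF S fl(2)] nz_proj[OF nz(1)] nz_proj[OF nz(2)] pos
    unfolding conformally_indecomposable_def by meson
qed

theorem theorem4p5:
  fixes S :: "('v, 'e) sgraph" and \<omega> :: "'e orient" and f :: "'e \<Rightarrow> int"
  assumes "signed_graph S" and "orientation S \<omega>"
    and "conformally_indecomposable S \<omega> f"
  shows "\<exists>W :: ('v, 'e) walk.
           directed_closed (support_subgraph S f) W (induced_dir (flow_orient \<omega> f) W) \<and>
           wsign S W = 1 \<and>
           (\<forall>e\<in>sg_edges S. f e = walk_flow \<omega> W (induced_dir (flow_orient \<omega> f) W) e) \<and>
           (\<forall>W'. walk_lift S W W' \<longrightarrow>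
              (let f' = walk_flow (lift_orient S \<omega>) W'
                          (lift_dir S W' (induced_dir (flow_orient \<omega> f) W))
               in circle_walk (double_cover S) W' \<and>
                  flow_lift S \<omega> f f' \<and>
                  conformally_indecomposable (double_cover S) (lift_orient S \<omega>) f'))"
proof -
  let ?\<tau> = "flow_orient \<omega> f" and ?D = "double_cover S" and ?\<rho> = "lift_orient S \<omega>"
  note S = assms(1) and f = assms(3)
  have fin: "finite (sg_edges S)"
    using S by (simp add: signed_graph_def)
  have \<tau>: "orientation S ?\<tau>"
    by (rule orientation_flow_orient[OF assms(2)])
  have "is_flow S ?\<tau> (\<lambda>e. \<bar>f e\<bar>)"
    using f unfolding is_flow_sgn1[symmetric] conformally_indecomposable_def by (simp add: sgn1_simps)
  moreover have "nonzero_on S (\<lambda>e. \<bar>f e\<bar>)"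
    using f by (auto simp: conformally_indecomposable_def nonzero_on_def)
  ultimately obtain p xs where c: "chain S ?\<tau> p xs p" and ne: "xs \<noteq> []"
    and le: "\<And>e. e \<in> sg_edges S \<Longrightarrow> edge_count xs e \<le> \<bar>f e\<bar>"
    using closed_chain_exists[OF S \<tau>] by (metis abs_ge_zero)
  have count: "edge_count xs e = \<bar>f e\<bar>" if "e \<in> sg_edges S" for e
    using closed_chain_carries_flow[OF fin f c ne le that] .
  define W where "W = (fst p, xs)"
  \<comment> \<open>An edge on the chain has positive count, and by \<open>count\<close> this is its
    value of \<bar>f\<bar>.\<close>
  have supp: "fst (xs ! i) \<in> sg_edges (support_subgraph S f)" if "i < length xs" for i
  proof -
    have e: "fst (xs ! i) \<in> sg_edges S" and "edge_count xs (fst (xs ! i)) \<noteq> 0"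
      using c that by (auto simp: chain_iff count_list_0_iff)
    then show ?thesis
      using count[OF e] by (simp add: support_subgraph_def)
  qed
  have state_supp: "state_at (support_subgraph S f) ?\<tau> p xs i = state_at S ?\<tau> p xs i" for i
    by (cases i) (simp_all add: head_state_def support_subgraph_def)
  have "chain (support_subgraph S f) ?\<tau> p xs p"
    using c supp unfolding chain_iff state_supp by (simp add: tail_state_def support_subgraph_def)
  moreover have "orientation (support_subgraph S f) ?\<tau>"
    using \<tau> by (simp add: orientation_def support_subgraph_def)
  \<comment> \<open>\<open>p\<close> is the tail state of step 0, whose edge lies in the
    support.\<close>
  moreover have "fst p \<in> sg_verts (support_subgraph S f)"
    using c ne supp[of 0] unfolding chain_iff
    by (force simp: support_subgraph_def tail_state_def)
  ultimately have "directed_closed (support_subgraph S f) W (induced_dir ?\<tau> W)"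
    unfolding W_def using ne by (intro chain_directed_closed)
  moreover have "wsign S W = 1"
    unfolding W_def by (rule chain_wsign[OF \<tau> c ne])
  moreover have "\<forall>e\<in>sg_edges S. f e = walk_flow \<omega> W (induced_dir ?\<tau> W) e"
    using count by (simp add: walk_flow_flow_orient[OF assms(2)] W_def sgn1_simps)
  moreover have "circle_walk ?D W' \<and> flow_lift S \<omega> f f' \<and> conformally_indecomposable ?D ?\<rho> f'"
    if W': "walk_lift S W W'" and f': "f' = walk_flow ?\<rho> W' (lift_dir S W' (induced_dir ?\<tau> W))"
    for W' f'
  proof -
    have walk: "is_walk ?D W'" and len: "wlen W' = length xs"
      using W' by (auto simp: walk_lift_def W_def)
    obtain k where k: "k \<in> {1, -1}"
      and c': "chain ?D (lift_orient S ?\<tau>) (fst W', k) (snd W') (fst W', k)"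
      and st: "\<And>i. i \<le> length xs \<Longrightarrow>
        state_at ?D (lift_orient S ?\<tau>) (fst W', k) (snd W') i =
          ((fst (state_at S ?\<tau> p xs i), k * snd (state_at S ?\<tau> p xs i)), k)"
      using lift_chain[OF \<tau> c ne W'[unfolded W_def]] by blast
    have v: "wvert ?D (fst W', snd W') i =
        (fst (state_at S ?\<tau> p xs i), k * snd (state_at S ?\<tau> p xs i))" if "i \<le> length xs" for i
      using wvert_eq_state_at[of ?D "(fst W', k)" "snd W'" i "lift_orient S ?\<tau>"] st[OF that] by simp
    \<comment> \<open>As \<open>k\<close> is a unit, equal vertices in the lift mean equal states
      below, and those are distinct.\<close>
    have "inj_on (wvert ?D (fst W', snd W')) {..<wlen W'}"
    proof (rule inj_onI)
      fix i j assume ij: "i \<in> {..<wlen W'}" "j \<in> {..<wlen W'}"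
        and "wvert ?D (fst W', snd W') i = wvert ?D (fst W', snd W') j"
      then have "state_at S ?\<tau> p xs i = state_at S ?\<tau> p xs j"
        using v[of i] v[of j] len k by (auto simp: prod_eq_iff)
      then show "i = j"
        using closed_chain_states_inj[OF fin f c le] ij len by (auto dest: inj_onD)
    qed
    then have "circle_walk ?D (fst W', snd W')"
      using k ne len walk st
      by (intro circle_walk_of_chain[OF c']) (auto simp: is_walk_def)
    then have circle: "circle_walk ?D W'" by simp
    have f'_eq: "f' e' = sgn1 (f (fst e')) * edge_count (snd W') e'" if "e' \<in> sg_edges ?D" for e'
      unfolding f' walk_flow_lift_dir[OF W'] lift_orient_flow_orient
      using walk_flow_flow_orient[OF orientation_lift_orient[OF S assms(2)] that, of W' "f \<circ> fst"] by simp
    have "finite (sg_edges ?D)"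
      using fin by simp
    \<comment> \<open>The counts of the lifted chain form a flow for the lifted reorientation;
      moving the signs back gives one for \<open>?\<rho>\<close>.\<close>
    from chain_closed_flow[OF this c']
    have "is_flow ?D ?\<rho> (\<lambda>e'. sgn1 ((f \<circ> fst) e') * edge_count (snd W') e')"
      unfolding is_flow_sgn1 lift_orient_flow_orient .
    then have "is_flow ?D ?\<rho> f'"
      by (rule is_flow_cong[THEN iffD2, rotated]) (simp add: f'_eq del: double_cover_simps)
    \<comment> \<open>Each occurrence of \<open>e\<close> in \<open>W\<close> becomes an occurrence
      of exactly one of its two lifts, so their counts add up to \<bar>f e\<bar>.\<close>
    moreover have "proj_fun f' e = f e" if "e \<in> sg_edges S" for e
      using that edge_count_lift[OF W', of e] count[OF that]
      by (simp add: proj_fun_def f'_eq W_def sgn1_simps flip: distrib_left)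
    ultimately have lift: "flow_lift S \<omega> f f'"
      by (simp add: flow_lift_def)
    have "sgn1 (f e) * f' (e, \<beta>) \<ge> 0" if "e \<in> sg_edges S" "\<beta> \<in> {1, -1}" for e \<beta>
      using that f'_eq[of "(e, \<beta>)"] by (simp add: mult.assoc[symmetric] sgn1_simps)
    then show ?thesis
      using circle lift conformally_indecomposable_lift[OF S f lift] by blast
  qed
  ultimately show ?thesis
    unfolding Let_def by blast
qed

end
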